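(* Let $G$ be a finite group. Then the following are equivalent: (i) $\Delta(G)=\Delta^o(G)$; (ii) $G$ is abelian.
   Context: All graphs are simple and undirected with vertex set $G$; equality of two such graphs means they have the same edge set. The commuting graph $\Delta(G)$: two distinct elements are adjacent iff they commute. Let $o(g)$ denote the order of $g\in G$. The order super commuting graph $\Delta^o(G)$ is the graph on $G$ in which two distinct elements $g,h$ are adjacent iff either $o(g)=o(h)$, or there exist $g',h'\in G$ with $o(g')=o(g)$, $o(h')=o(h)$ such that $g'$ and $h'$ are distinct and commute. *)

theory Defs
  imports "HOL-Algebra.Multiplicative_Group" "Graph_Theory.Pair_Digraph"
begin

text \<open>
  A simple undirected graph is a loop-free symmetric digraph without parallel arcs, i.e. an
  edge \<open>{g, h}\<close> is the pair of arcs \<open>(g, h)\<close> and \<open>(h, g)\<close> (see \<^locale>\<open>pair_graph\<close>).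
  Both graphs below have vertex set \<open>carrier G\<close>, so they are equal as records
  exactly when they have the same edges.
\<close>

definition commuting_graph :: "('a, 'b) monoid_scheme \<Rightarrow> 'a pair_pre_digraph" where
  "commuting_graph G =
    \<lparr> pverts = carrier G,
      parcs = {(g, h). g \<in> carrier G \<and> h \<in> carrier G \<and> g \<noteq> h \<and>
                       g \<otimes>\<^bsub>G\<^esub> h = h \<otimes>\<^bsub>G\<^esub> g} \<rparr>"

definition order_super_commuting_graph :: "('a, 'b) monoid_scheme \<Rightarrow> 'a pair_pre_digraph" where
  "order_super_commuting_graph G =
    \<lparr> pverts = carrier G,
      parcs = {(g, h). g \<in> carrier G \<and> h \<in> carrier G \<and> g \<noteq> h \<and>
                (group.ord G g = group.ord G h \<or>
                 (\<exists>g' \<in> carrier G. \<exists>h' \<in> carrier G.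
                    group.ord G g' = group.ord G g \<and> group.ord G h' = group.ord G h \<and>
                    g' \<noteq> h' \<and> g' \<otimes>\<^bsub>G\<^esub> h' = h' \<otimes>\<^bsub>G\<^esub> g'))} \<rparr>"

lemma pair_graph_commuting_graph:
  assumes "finite (carrier G)"
  shows "pair_graph (commuting_graph G)"
proof -
  have "finite (parcs (commuting_graph G))"
    by (rule finite_subset[of _ "carrier G \<times> carrier G"])
       (auto simp: commuting_graph_def assms)
  then show ?thesis
    by unfold_locales
       (auto simp: commuting_graph_def assms symmetric_def intro!: symI)
qed

lemma pair_graph_order_super_commuting_graph:
  assumes "finite (carrier G)"
  shows "pair_graph (order_super_commuting_graph G)"
proof -
  have "finite (parcs (order_super_commuting_graph G))"
    by (rule finite_subset[of _ "carrier G \<times> carrier G"])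
       (auto simp: order_super_commuting_graph_def assms)
  moreover have "sym (parcs (order_super_commuting_graph G))"
    by (rule symI) (simp add: order_super_commuting_graph_def, metis)
  ultimately show ?thesis
    by unfold_locales
       (auto simp: order_super_commuting_graph_def assms symmetric_def)
qed

end

theory Submission
  imports Defs "HOL-Computational_Algebra.Primes"
begin

text \<open>
  If the two graphs agree, then elements of the same order commute. More generally \<open>x\<close> and \<open>y\<close>
  commute as soon as \<open>o(x)\<close> divides \<open>o(y)\<close>, because a power of \<open>y\<close> has order \<open>o(x)\<close>.
  If \<open>o(x)\<close> and \<open>o(y)\<close> are coprime, the commutator of \<open>x\<close> and \<open>y\<close> is a product of
  \<open>x\<close> with a conjugate of its inverse, and also of \<open>y\<inverse>\<close> with a conjugate of its inverse;
  as conjugates commute, its order divides both \<open>o(x)\<close> and \<open>o(y)\<close>, so it is trivial.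
  Hence any two elements of prime power order commute, and these generate the group.
\<close>

text \<open>Conjugation commutes with taking powers and sends only \<open>\<one>\<close> to
  \<open>\<one>\<close>, so \<open>x\<close> and its conjugate have the same exponents that
  annihilate them.\<close>

lemma (in group) ord_conj:
  assumes "x \<in> carrier G" "y \<in> carrier G"
  shows "ord (y \<otimes> x \<otimes> inv y) = ord x"
proof -
  have pow: "(y \<otimes> x \<otimes> inv y) [^] n = y \<otimes> x [^] n \<otimes> inv y" for n :: nat
  proof (induction n)
    case (Suc n)
    have "(y \<otimes> x [^] n \<otimes> inv y) \<otimes> (y \<otimes> x \<otimes> inv y)
          = y \<otimes> (x [^] n \<otimes> (inv y \<otimes> y \<otimes> (x \<otimes> inv y)))"
      using assms by (simp only: m_assoc m_closed inv_closed nat_pow_closed)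
    with Suc assms show ?case by (simp add: m_assoc)
  qed (use assms in simp)
  have "y \<otimes> z \<otimes> inv y = \<one> \<longleftrightarrow> z = \<one>" if "z \<in> carrier G" for z
    using that assms by (metis inv_solve_right' l_one m_closed one_closed l_cancel_one)
  then show ?thesis
    using assms by (subst ord_unique) (simp_all add: pow pow_eq_id)
qed

lemma (in group) coprime_ord_commute:
  assumes same: "\<And>a b. \<lbrakk>a \<in> carrier G; b \<in> carrier G; ord a = ord b\<rbrakk> \<Longrightarrow> a \<otimes> b = b \<otimes> a"
    and x: "x \<in> carrier G" and y: "y \<in> carrier G"
    and cop: "coprime (ord x) (ord y)"
  shows "x \<otimes> y = y \<otimes> x"
proof -
  \<comment> \<open>By \<open>same\<close>, \<open>a\<close> and \<open>b\<close> commute, so the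
    \<open>n\<close>-th power of the product is the product of two trivial powers.\<close>
  have dvd: "ord (a \<otimes> b) dvd n"
    if "a \<in> carrier G" "b \<in> carrier G" "ord a = n" "ord b = n" for a b n
  proof -
    have "(a \<otimes> b) [^] n = a [^] n \<otimes> b [^] n"
      using that same by (intro pow_mult_distrib) auto
    with that show ?thesis
      by (metis m_closed one_closed pow_eq_id pow_ord_eq_1 r_one)
  qed
  define c where "c = x \<otimes> y \<otimes> inv x \<otimes> inv y"
  \<comment> \<open>Grouped this way, \<open>c\<close> is \<open>x\<close> times a conjugate of
    \<open>inv x\<close>; grouped as in \<open>c_def\<close>, it is a conjugate of \<open>y\<close>
    times \<open>inv y\<close>.\<close>
  have c: "c = x \<otimes> (y \<otimes> inv x \<otimes> inv y)"
    using x y by (simp add: c_def m_assoc)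
  have "ord c dvd ord x"
    unfolding c using x y by (intro dvd) (simp_all add: ord_conj)
  moreover have "ord c dvd ord y"
    unfolding c_def using x y by (intro dvd) (simp_all add: ord_conj)
  ultimately have "ord c = 1"
    using cop by (meson coprime_common_divisor_nat)
  then have "c = \<one>"
    using x y by (subst (asm) ord_eq_1) (auto simp: c_def)
  then have "x \<otimes> y \<otimes> inv x = y"
    using x y by (metis c_def inv_closed inv_equality inv_inv m_closed)
  then show ?thesis
    using x y by (metis inv_closed inv_solve_right m_closed)
qed

text \<open>By Bezout, \<open>x\<close> lies in the subgroup generated by \<open>x [^] k\<close> and
  \<open>x [^] m\<close>, hence in the centralizer of \<open>y\<close>.\<close>

lemma (in group) commute_if_coprime_powers_commute:
  assumes x: "x \<in> carrier G" and y: "y \<in> carrier G"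
    and cop: "coprime k m" and "k \<noteq> 0"
    and k: "x [^] (k::nat) \<otimes> y = y \<otimes> x [^] k"
    and m: "x [^] (m::nat) \<otimes> y = y \<otimes> x [^] m"
  shows "x \<otimes> y = y \<otimes> x"
proof -
  obtain u v where "k * u = m * v + 1"
    using bezout_nat[OF \<open>k \<noteq> 0\<close>, of m] cop by auto
  then have e: "(x [^] k) [^] u = (x [^] m) [^] v \<otimes> x"
    using x by (simp add: nat_pow_pow)
  define a where "a = (x [^] m) [^] v"
  have a: "a \<in> carrier G" using x by (simp add: a_def)
  have "(x [^] k) [^] u \<otimes> y = y \<otimes> (x [^] k) [^] u"
    using x y k by (simp add: group_commutes_pow)
  \<comment> \<open>Here \<open>a \<otimes> x\<close> is a power of \<open>x [^] k\<close>. Since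
    \<open>a\<close> also commutes with \<open>y\<close>, it can be moved to the left on both sides
    and cancelled.\<close>
  then have "a \<otimes> (x \<otimes> y) = y \<otimes> a \<otimes> x"
    using e x y a by (simp add: m_assoc a_def)
  also have "y \<otimes> a = a \<otimes> y"
    unfolding a_def using x y m by (simp add: group_commutes_pow)
  finally show ?thesis
    using a x y by (simp add: m_assoc)
qed

text \<open>Induction on \<open>ord x\<close>: splitting off the full power of one prime gives
  \<open>ord x = k * m\<close> with coprime factors, and \<open>x [^] m\<close>,
  \<open>x [^] k\<close> have orders \<open>k\<close> and \<open>m\<close>. Keeping \<open>y\<close>
  fixed lets the lemma be applied to each side of a commuting pair in turn.\<close>

lemma (in group) commute_if_prime_power_ord_commute:
  assumes y: "y \<in> carrier G"
    and pp: "\<And>x p i. \<lbrakk>x \<in> carrier G; prime (p::nat); ord x = p ^ i\<rbrakk> \<Longrightarrow> x \<otimes> y = y \<otimes> x"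
    and "x \<in> carrier G" and "ord x > 0"
  shows "x \<otimes> y = y \<otimes> x"
  using assms(3,4)
proof (induction "ord x" arbitrary: x rule: less_induct)
  case less
  show ?case
  proof (cases "ord x = 1")
    case True
    then show ?thesis using less.prems y ord_eq_1 by simp
  next
    case False
    then obtain p where p: "prime p" "p dvd ord x"
      using prime_factor_nat by blast
    have "ord x \<noteq> 0" "\<not> is_unit p"
      using less.prems p not_prime_unit by auto
    then obtain m where "ord x = p ^ multiplicity p (ord x) * m" and m: "\<not> p dvd m"
      by (rule multiplicity_decompose')
    then obtain i where i: "ord x = p ^ i * m" by blast
    define k where "k = p ^ i"
    have ord: "ord x = k * m" using i by (simp add: k_def)
    with less.prems have pos: "k > 0" "m > 0" by auto
    \<comment> \<open>This makes \<open>m\<close> smaller than \<open>ord x\<close>, so the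
      induction hypothesis covers \<open>x [^] k\<close>.\<close>
    have "i \<noteq> 0"
      using p m i by (cases i) auto
    then have "k > 1"
      unfolding k_def using prime_gt_1_nat[OF p(1)] by (intro one_less_power) auto
    have cop: "coprime k m"
      unfolding k_def using prime_imp_coprime[OF p(1) m] by simp
    have "ord (x [^] m) = k"
      using ord_pow[of x m] ord pos less.prems by simp
    then have "x [^] m \<otimes> y = y \<otimes> x [^] m"
      using pp[of "x [^] m" p i] p(1) less.prems(1) by (simp add: k_def)
    moreover have ordk: "ord (x [^] k) = m"
      using ord_pow[of x k] ord pos less.prems by simp
    then have "x [^] k \<otimes> y = y \<otimes> x [^] k"
      using less.hyps[of "x [^] k"] ord pos \<open>k > 1\<close> less.prems by simp
    ultimately show ?thesis
      using less.prems(1) pos(1)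
      by - (rule commute_if_coprime_powers_commute[OF _ y cop], simp_all)
  qed
qed

lemma (in group) commute_if_dvd_ord_commute:
  assumes fin: "finite (carrier G)"
    and dvd: "\<And>a b. \<lbrakk>a \<in> carrier G; b \<in> carrier G; ord a dvd ord b\<rbrakk> \<Longrightarrow> a \<otimes> b = b \<otimes> a"
    and x: "x \<in> carrier G" and y: "y \<in> carrier G"
  shows "x \<otimes> y = y \<otimes> x"
proof -
  have pos: "ord a > 0" if "a \<in> carrier G" for a
    using ord_ge_1[OF fin that] by simp
  have prime_powers: "a \<otimes> b = b \<otimes> a"
    if "a \<in> carrier G" "b \<in> carrier G" "prime p" "prime q" "ord a = p ^ i" "ord b = q ^ j"
    for a b i j and p q :: nat
  proof (cases "p = q")
    case True
    \<comment> \<open>Powers of the same prime are linearly ordered by divisibility.\<close>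
    have "ord a dvd ord b \<or> ord b dvd ord a"
      using that True by (metis le_imp_power_dvd linear)
    then show ?thesis using that dvd by metis
  next
    case False
    then have "coprime (ord a) (ord b)"
      using that primes_coprime_nat by simp
    with that(1,2) show ?thesis
      by (rule coprime_ord_commute[rotated]) (rule dvd, simp_all)
  qed
  \<comment> \<open>First reduction: \<open>a\<close> is the fixed element and \<open>y\<close> is
    decomposed. The second one fixes \<open>y\<close> and decomposes \<open>x\<close>.\<close>
  have "a \<otimes> y = y \<otimes> a" if "a \<in> carrier G" "prime p" "ord a = p ^ i" for a i and p :: nat
    using commute_if_prime_power_ord_commute[of a y] prime_powers that y pos by metis
  then show ?thesis
    by (rule commute_if_prime_power_ord_commute[OF y _ x pos[OF x]])
qed

theorem theorem3p4:
  fixes G (structure)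
  assumes "group G" and "finite (carrier G)"
  shows "commuting_graph G = order_super_commuting_graph G \<longleftrightarrow> comm_group G"
proof
  interpret group G by fact
  assume "commuting_graph G = order_super_commuting_graph G"
  then have arcs: "parcs (commuting_graph G) = parcs (order_super_commuting_graph G)"
    by simp
  have "a \<otimes> b = b \<otimes> a" if ab: "a \<in> carrier G" "b \<in> carrier G" "ord a dvd ord b" for a b
  proof (cases "a = b")
    case False
    have "(a, b) \<in> parcs (order_super_commuting_graph G)"
    proof (cases "ord a = ord b")
      case True
      with ab False show ?thesis by (simp add: order_super_commuting_graph_def)
    next
      case neq: False
      \<comment> \<open>The witnesses for adjacency of \<open>a\<close> and \<open>b\<close> are
        \<open>b [^] k\<close> and \<open>b\<close>: they commute, \<open>b [^] k\<close> has the
        order of \<open>a\<close>, and they differ because their orders do.\<close>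
      obtain k where k: "ord b = ord a * k" using ab by auto
      then have pos: "ord a > 0" "k > 0"
        using ord_ge_1[OF assms(2) ab(2)] by (auto intro: Nat.gr0I)
      then have "ord (b [^] k) = ord a"
        using ord_pow[of b k] k ab(2) by simp
      moreover from this neq have "b [^] k \<noteq> b" by metis
      moreover have "b [^] k \<otimes> b = b \<otimes> b [^] k"
        using ab by (intro group_commutes_pow) auto
      ultimately show ?thesis
        using ab False nat_pow_closed[OF ab(2)]
        unfolding order_super_commuting_graph_def by auto
    qed
    then have "(a, b) \<in> parcs (commuting_graph G)"
      using arcs by simp
    then show ?thesis by (simp add: commuting_graph_def)
  qed simp
  then show "comm_group G"
    using commute_if_dvd_ord_commute assms(2)
    by (intro group_comm_groupI) blast
next
  assume "comm_group G"
  then interpret comm_group G .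
  \<comment> \<open>The witnesses are \<open>g\<close> and \<open>h\<close> themselves, so in the
    abelian case both graphs are complete.\<close>
  have "\<exists>g' \<in> carrier G. \<exists>h' \<in> carrier G. ord g' = ord g \<and> ord h' = ord h \<and>
          g' \<noteq> h' \<and> g' \<otimes> h' = h' \<otimes> g'"
    if "g \<in> carrier G" "h \<in> carrier G" "g \<noteq> h" for g h
    using that m_comm by blast
  then have "parcs (commuting_graph G) = parcs (order_super_commuting_graph G)"
    unfolding commuting_graph_def order_super_commuting_graph_def
    by (auto intro: m_comm)
  then show "commuting_graph G = order_super_commuting_graph G"
    by (simp add: commuting_graph_def order_super_commuting_graph_def)
qed

end
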